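(* Let $n\ge1$, $k\ge1$, $l\in\{0,\dots,2n\}$, and let $t_1,\dots,t_k$ be positive even integers with $t=t_1+\dots+t_k\in\{1,\dots,n\}$, $2\le t\le\min\{l,2n-l\}$ and $l-t$ even. Let $$\mathbf a=\bigoplus_{i=1}^k\mathbf A_i\in SpT_{2n}(\varpi_t),\qquad \mathbf A_i=(a_i,a_i+1,\dots,a_i+t_i-1),\quad a_i\text{ odd}\quad(1\le i\le k).$$ Then $a_i\ge2(t_1+\dots+t_{i-1})+t_i+1$ for $1\le i\le k$. Moreover, define recursively, for $i=1,\dots,k$, $$l_i=\min\Big(\Big\{\big(a_j-2\sum_{m=1}^{j-1}t_m-t_j-1\big)-\sum_{m=1}^{i-1}l_m:\ i\le j\le k\Big\}\cup\Big\{l-t-\sum_{m=1}^{i-1}l_m\Big\}\Big),$$ and $l_{t+1}=l-t-\sum_{i=1}^kl_i$. Then $l_1,\dots,l_k,l_{t+1}$ are nonnegative even numbers, and the concatenation $$T=(1,\dots,l_1)\,\mathbf A_1\,(a_1+t_1,\dots,a_1+t_1-1+l_2)\,\mathbf A_2\,(a_2+t_2,\dots,a_2+t_2-1+l_3)\cdots\mathbf A_{k-1}\,(a_{k-1}+t_{k-1},\dots,a_{k-1}+t_{k-1}-1+l_k)\,\mathbf A_k\,(a_k+t_k,\dots,a_k+t_k-1+l_{t+1})$$ (each inserted interval having the indicated even length $l_1,l_2,\dots,l_k,l_{t+1}$, and being empty if that length is $0$) is an element of $SST_{2n}(\varpi_l)$ with $\mathrm{red}(T)=\mathbf a$; that is,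 $T=\mathrm{red}_t^{-1}(\mathbf a)$ is the unique preimage of $\mathbf a$ in $SST_{2n}(\varpi_l)$ under the reduction map.
   Context: $SST_{2n}(\varpi_l)$ is the set of columns of length $l$ on the alphabet $\{1,\dots,2n\}$, i.e. strictly increasing sequences $(b_1<\dots<b_l)$ with entries in $\{1,\dots,2n\}$, often identified with the set of entries. $SpT_{2n}(\varpi_t)\subseteq SST_{2n}(\varpi_t)$ is the subset of symplectic columns: $b_k\ge2k-1$ for all $k$. The notation $\mathbf a=\bigoplus_{i=1}^k\mathbf A_i$ means that $\mathbf a$ is the disjoint union of the intervals $\mathbf A_i=(a_i,a_i+1,\dots,a_i+t_i-1)$ with $a_i$ odd, $t_i\ge2$ even, and $a_{i+1}-a_i\ge t_i+2$ for $1\le i\le k-1$. For a column $\mathbf b=(b_1,\dots,b_l)$ the removal subword $\mathrm{rem}(\mathbf b)$ is defined recursively: $\mathrm{rem}(\mathbf b)=\emptyset$ if $l\le1$; if $l\ge2$, $b_l$ is even, $b_{l-1}=b_l-1$ and $b_l<2l-|\mathrm{rem}(b_1,\dots,b_{l-2})|-1$, then $\mathrm{rem}(\mathbf b)=\mathrm{rem}(b_1,\dots,b_{l-2})\cup\{b_{l-1},b_l\}$; otherwise $\mathrm{rem}(\mathbf b)=\mathrm{rem}(b_1,\dots,b_{l-1})$. The reduction of $\mathbf b$ is $\mathrm{red}(\mathbf b)=\mathbf b\setminus\mathrm{rem}(\mathbf b)$. It is known (Watanabe) that $\mathrm{red}$ is injective on $SST_{2n}(\varpi_l)$ and takes values in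 $\bigsqcup_t SpT_{2n}(\varpi_t)$ over $0\le t\le\min\{l,2n-l\}$, $l-t$ even; $\mathrm{red}_t^{-1}(\mathbf a)=T$ means $T\in SST_{2n}(\varpi_l)$ and $\mathrm{red}(T)=\mathbf a$. *)

theory Defs
  imports Main
begin

(* Columns are lists of integers; the entry written b_k on paper is b ! (k - 1). *)

definition SST :: "nat \<Rightarrow> nat \<Rightarrow> int list set" where
  "SST N l = {b. length b = l \<and> sorted_wrt (<) b \<and> set b \<subseteq> {1..int N}}"

definition SpT :: "nat \<Rightarrow> nat \<Rightarrow> int list set" where
  "SpT N t = {b \<in> SST N t. \<forall>k\<in>{1..t}. b ! (k - 1) \<ge> 2 * int k - 1}"

fun removal :: "int list \<Rightarrow> int set" where
  "removal b =
    (if length b \<le> 1 then {}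
     else let l = length b; r = removal (take (l - 2) b) in
       if even (b ! (l - 1)) \<and> b ! (l - 2) = b ! (l - 1) - 1 \<and>
          b ! (l - 1) < 2 * int l - int (card r) - 1
       then r \<union> {b ! (l - 2), b ! (l - 1)}
       else removal (take (l - 1) b))"

declare removal.simps [simp del]

definition red :: "int list \<Rightarrow> int list" where
  "red b = filter (\<lambda>x. x \<notin> removal b) b"

(* The families a and t are indexed by 1, ..., k; their other values are irrelevant. *)

definition block :: "(nat \<Rightarrow> int) \<Rightarrow> (nat \<Rightarrow> nat) \<Rightarrow> nat \<Rightarrow> int list" where
  "block a t i = [a i..a i + int (t i) - 1]"

definition is_block_sum :: "int list \<Rightarrow> nat \<Rightarrow> (nat \<Rightarrow> int) \<Rightarrow> (nat \<Rightarrow> nat) \<Rightarrow> bool" where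
  "is_block_sum c k a t \<longleftrightarrow>
     c = concat (map (block a t) [1..<Suc k]) \<and>
     (\<forall>i\<in>{1..k}. odd (a i) \<and> t i \<ge> 2 \<and> even (t i)) \<and>
     (\<forall>i. 1 \<le> i \<and> i < k \<longrightarrow> a (Suc i) - a i \<ge> int (t i) + 2)"

fun gap :: "(nat \<Rightarrow> int) \<Rightarrow> (nat \<Rightarrow> nat) \<Rightarrow> nat \<Rightarrow> nat \<Rightarrow> nat \<Rightarrow> int" where
  "gap a t k l i = Min (
     {(a j - 2 * (\<Sum>m = 1..<j. int (t m)) - int (t j) - 1) - (\<Sum>m = 1..<i. gap a t k l m) | j.
        i \<le> j \<and> j \<le> k}
     \<union> {int l - (\<Sum>m = 1..k. int (t m)) - (\<Sum>m = 1..<i. gap a t k l m)})"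

declare gap.simps [simp del]

(* The remaining length, filling up the column after the last block. *)
definition last_gap :: "(nat \<Rightarrow> int) \<Rightarrow> (nat \<Rightarrow> nat) \<Rightarrow> nat \<Rightarrow> nat \<Rightarrow> int" where
  "last_gap a t k l = int l - (\<Sum>m = 1..k. int (t m)) - (\<Sum>i = 1..k. gap a t k l i)"

(* An interval [x..y] of integers is the empty list when y < x, in particular for a gap of length 0. *)
definition filled :: "(nat \<Rightarrow> int) \<Rightarrow> (nat \<Rightarrow> nat) \<Rightarrow> nat \<Rightarrow> nat \<Rightarrow> int list" where
  "filled a t k l =
     [1..gap a t k l 1] @
     concat (map (\<lambda>i. block a t i @
        [a i + int (t i)..a i + int (t i) - 1 +
           (if i < k then gap a t k l (Suc i) else last_gap a t k l)]) [1..<Suc k])"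

end

(*
  Group the entries 1, ..., 2N into pairs {2i+1, 2i+2} and scan a column from left to right,
  keeping a depth that starts at 0: a pair that is full lowers it by one, stopping at 0, an
  empty pair raises it by one, and a pair with one entry leaves it unchanged. A full pair is
  removed exactly when it is met at depth 0.

  Injectivity: let two columns have the same reduction and differ for the first time at a pair
  that only one of them removes. From then on the depth of the other one is larger, and it stays
  larger, as only the column of smaller depth can be at depth 0 and remove a pair. But the final
  depth is determined by the lengths of the column and of its reduction.

  Existence: the partial sums G_i = l_1 + ... + l_i are the minima of l - t and of the numbers
  r_j = a_j - 2 (t_1 + ... + t_{j-1}) - t_j - 1 with j >= i. Before the block A_i the depth is
  (r_i - G_i + t_i) / 2, so no pair of the block is met at depth 0. If the gap after the block is
  nonempty, then G_i = r_i, so the depth is 0 there and the whole inserted interval is removed.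
*)
theory Submission
  imports Defs
begin

section \<open>Pairs of entries and the depth of the scan\<close>

definition pairs :: "nat set \<Rightarrow> int set" where
  "pairs I = (\<Union>i\<in>I. {2 * int i + 1, 2 * int i + 2})"

text \<open>\<open>depth B i\<close> is the value just before pair \<open>i\<close> is read, with
  pairs numbered from 0. Truncated subtraction is what stops the depth at 0.\<close>

primrec depth :: "int set \<Rightarrow> nat \<Rightarrow> nat" where
  "depth B 0 = 0"
| "depth B (Suc i) =
    (if 2 * int i + 1 \<in> B \<and> 2 * int i + 2 \<in> B then depth B i - 1
     else if 2 * int i + 1 \<in> B \<or> 2 * int i + 2 \<in> B then depth B i
     else Suc (depth B i))"

definition removed_pairs :: "int set \<Rightarrow> nat set" where
  "removed_pairs B = {i. 2 * int i + 1 \<in> B \<and> 2 * int i + 2 \<in> B \<and> depth B i = 0}"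

lemma odd_mem_pairs [simp]: "2 * int i + 1 \<in> pairs I \<longleftrightarrow> i \<in> I"
  unfolding pairs_def by (auto; presburger)

lemma even_mem_pairs [simp]: "2 * int i + 2 \<in> pairs I \<longleftrightarrow> i \<in> I"
  unfolding pairs_def by (auto; presburger)

text \<open>Blocks and gaps start at an odd entry and have even length, so this lets them be handled
  as half-open ranges of pair indices.\<close>

lemma pairs_interval: "pairs {p..<q} = {2 * int p + 1..2 * int q}"
proof
  show "{2 * int p + 1..2 * int q} \<subseteq> pairs {p..<q}"
  proof
    fix x assume "x \<in> {2 * int p + 1..2 * int q}"
    then have "nat ((x - 1) div 2) \<in> {p..<q}"
      and "x = 2 * int (nat ((x - 1) div 2)) + 1 \<or> x = 2 * int (nat ((x - 1) div 2)) + 2"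
      by auto
    then show "x \<in> pairs {p..<q}" unfolding pairs_def by blast
  qed
qed (auto simp: pairs_def)

lemma pairs_UN: "pairs (\<Union>i\<in>I. f i) = (\<Union>i\<in>I. pairs (f i))"
  by (auto simp: pairs_def)

lemma pairs_Diff: "pairs (I - J) = pairs I - pairs J"
proof -
  have "x \<notin> pairs J" if "x = 2 * int i + 1 \<or> x = 2 * int i + 2" "i \<notin> J" for x i
    using that by auto
  then show ?thesis unfolding pairs_def[of I] pairs_def[of "I - J"] by (auto simp: pairs_def)
qed

lemma finite_pairs: "finite I \<Longrightarrow> finite (pairs I)"
  by (auto simp: pairs_def)

lemma card_pairs: assumes "finite I" shows "card (pairs I) = 2 * card I"
  using assms
proof (induction I)
  case empty then show ?case by (simp add: pairs_def)
next
  case (insert i I)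
  have "pairs (insert i I) = insert (2 * int i + 1) (insert (2 * int i + 2) (pairs I))"
    by (simp add: pairs_def)
  then show ?case using insert finite_pairs[of I] by simp
qed

lemma pairs_removed_subset: "pairs (removed_pairs B) \<subseteq> B"
  by (auto simp: pairs_def removed_pairs_def)

section \<open>The removal word located by depth\<close>

lemma depth_cong:
  assumes "\<And>x. 1 \<le> x \<Longrightarrow> x \<le> 2 * int i \<Longrightarrow> x \<in> B \<longleftrightarrow> x \<in> B'"
  shows "depth B i = depth B' i"
  using assms
proof (induction i)
  case (Suc i)
  have "depth B i = depth B' i"
    by (rule Suc.IH) (rule Suc.prems, simp_all)
  then show ?case using Suc.prems[of "2 * int i + 1"] Suc.prems[of "2 * int i + 2"] by simp
qed simp

text \<open>Reading a pair raises entry count plus depth by one, except that a full pair met at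
  depth 0, whose drop is cut off, raises it by two. This invariant converts the numerical test in
  \<open>removal\<close> into a test on depth.\<close>

lemma card_add_depth:
  "card (B \<inter> {1..2 * int i}) + depth B i = i + card (removed_pairs B \<inter> {..<i})"
proof (induction i)
  case (Suc i)
  let ?x = "2 * int i + 1" and ?y = "2 * int i + 2"
  have iv: "{1..2 * int (Suc i)} = insert ?x (insert ?y {1..2 * int i})" by auto
  have c: "card (B \<inter> {1..2 * int (Suc i)}) =
      card (B \<inter> {1..2 * int i}) + (if ?x \<in> B then 1 else 0) + (if ?y \<in> B then 1 else 0)"
    unfolding iv by (simp add: Int_insert_right)
  have r: "card (removed_pairs B \<inter> {..<Suc i}) =
      card (removed_pairs B \<inter> {..<i}) + (if i \<in> removed_pairs B then 1 else 0)"
    by (simp add: lessThan_Suc Int_insert_right)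
  show ?case
    using Suc.IH unfolding c r by (auto simp: removed_pairs_def)
qed simp

lemma removed_pairs_cong:
  assumes "\<And>x. 1 \<le> x \<Longrightarrow> x \<le> 2 * int m \<Longrightarrow> x \<in> B \<longleftrightarrow> x \<in> B'" and "i < m"
  shows "i \<in> removed_pairs B \<longleftrightarrow> i \<in> removed_pairs B'"
proof -
  have "depth B i = depth B' i"
    by (rule depth_cong) (rule assms, use \<open>i < m\<close> in simp_all)
  then show ?thesis using assms(1)[of "2 * int i + 1"] assms(1)[of "2 * int i + 2"] \<open>i < m\<close>
    by (simp add: removed_pairs_def)
qed

text \<open>Induction on the length, peeling off the last two entries \<open>x\<close> and
  \<open>y\<close>, because the recursion looks at the prefixes \<open>b0\<close> and
  \<open>b0 @ [x]\<close>. Whether a pair is removed depends only on the entries up to it.\<close>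

lemma removal_eq:
  assumes "sorted_wrt (<) b" "\<forall>x\<in>set b. 1 \<le> x"
  shows "removal b = pairs (removed_pairs (set b))"
  using assms
proof (induction "length b" arbitrary: b rule: less_induct)
  case less
  show ?case
  proof (cases "length b \<le> 1")
    case True
    have "card (set b) \<le> 1" using card_length[of b] True by linarith
    then have "x = y" if "x \<in> set b" "y \<in> set b" for x y
      using that card_le_Suc0_iff_eq[of "set b"] by auto
    then have "removed_pairs (set b) = {}" by (fastforce simp: removed_pairs_def)
    then show ?thesis using True by (subst removal.simps) (simp add: pairs_def)
  next
    case False
    then obtain c y where "b = c @ [y]" by (cases b rule: rev_exhaust) auto
    moreover with False obtain b0 x where "c = b0 @ [x]" by (cases c rule: rev_exhaust) auto
    ultimately have b: "b = b0 @ [x, y]" by simp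
    let ?B = "set b"
    have ord: "\<forall>z\<in>set b0. 1 \<le> z \<and> z < x" "1 \<le> x" "x < y" "sorted_wrt (<) b0"
      using less.prems unfolding b by (auto simp: sorted_wrt_append)
    have IH0: "removal b0 = pairs (removed_pairs (set b0))"
      using less.hyps[of b0] less.prems unfolding b by (auto simp: sorted_wrt_append)
    have IH1: "removal (b0 @ [x]) = pairs (removed_pairs (set (b0 @ [x])))"
      using less.hyps[of "b0 @ [x]"] less.prems unfolding b by (auto simp: sorted_wrt_append)
    have len: "length b = length b0 + 2" unfolding b by simp
    have rem: "removal b =
       (if even y \<and> x = y - 1 \<and> y < 2 * int (length b) - int (card (removal b0)) - 1
        then removal b0 \<union> {x, y} else removal (b0 @ [x]))"
      unfolding b by (subst removal.simps) (simp add: Let_def nth_append)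
    show ?thesis
    proof (cases "even y \<and> x = y - 1")
      case True
      then obtain i where i: "x = 2 * int i + 1" "y = 2 * int i + 2"
      proof -
        assume *: "\<And>i. x = 2 * int i + 1 \<Longrightarrow> y = 2 * int i + 2 \<Longrightarrow> thesis"
        from True ord(2) show ?thesis by (intro *[of "nat ((y - 2) div 2)"]) auto
      qed
      \<comment> \<open>As \<open>x\<close> opens pair \<open>i\<close>, all of \<open>b0\<close>
        lies in earlier pairs, so the scan of \<open>b\<close> up to pair \<open>i\<close> sees
        exactly \<open>b0\<close>.\<close>
      have B0: "set b0 \<inter> {1..2 * int i} = set b0" using ord i by fastforce
      have B: "z \<in> ?B \<longleftrightarrow> z \<in> set b0" if "1 \<le> z" "z \<le> 2 * int i" for z
        unfolding b i using that by auto
      have dep: "depth ?B i = depth (set b0) i" by (rule depth_cong) (rule B)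
      have sub0: "removed_pairs (set b0) \<subseteq> {..<i}"
        using ord i by (fastforce simp: removed_pairs_def)
      have sub: "removed_pairs ?B \<subseteq> {..<Suc i}"
        using ord i unfolding b by (fastforce simp: removed_pairs_def)
      have "j \<in> removed_pairs ?B \<longleftrightarrow>
          j \<in> removed_pairs (set b0) \<union> (if depth ?B i = 0 then {i} else {})" for j
      proof (cases j i rule: linorder_cases)
        case less
        then show ?thesis using removed_pairs_cong[of i ?B "set b0" j] B by simp
      next
        case equal
        then show ?thesis using sub0 unfolding removed_pairs_def[of ?B] by (auto simp: b i)
      next
        case greater
        then show ?thesis using sub sub0 by auto
      qed
      then have rp: "removed_pairs ?B =
          removed_pairs (set b0) \<union> (if depth ?B i = 0 then {i} else {})"
        by blast
      have "length b0 + depth ?B i = i + card (removed_pairs (set b0))"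
        using card_add_depth[of "set b0" i] sub0 ord(4) unfolding B0 dep
        by (simp add: Int_absorb2 distinct_card strict_sorted_iff)
      moreover have "card (removal b0) = 2 * card (removed_pairs (set b0))"
        unfolding IH0 by (rule card_pairs) (rule finite_subset[OF sub0], simp)
      \<comment> \<open>By the counting invariant the right side equals
        \<open>2 * i + 3 - 2 * depth ?B i\<close>, to be compared with
        \<open>y = 2 * i + 2\<close>.\<close>
      ultimately have cond: "y < 2 * int (length b) - int (card (removal b0)) - 1
          \<longleftrightarrow> depth ?B i = 0"
        unfolding i len by auto
      show ?thesis
      proof (cases "depth ?B i = 0")
        case True
        have "removal b = removal b0 \<union> {x, y}"
          using rem cond True \<open>even y \<and> x = y - 1\<close> by simp
        then show ?thesis unfolding IH0 rp using True by (simp add: pairs_def i)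
      next
        \<comment> \<open>The recursion now drops only \<open>y\<close>. Without its partner,
          \<open>x\<close> completes no pair, so \<open>b0 @ [x]\<close> has the removed pairs of
          \<open>b0\<close>.\<close>
        case False
        have "j \<in> removed_pairs (set (b0 @ [x])) \<longleftrightarrow> j \<in> removed_pairs (set b0)" if "j < i" for j
          by (rule removed_pairs_cong[OF _ that]) (use i in auto)
        moreover have "removed_pairs (set (b0 @ [x])) \<subseteq> {..<i}"
          using ord i by (fastforce simp: removed_pairs_def)
        ultimately have "removed_pairs (set (b0 @ [x])) = removed_pairs (set b0)"
          using sub0 by blast
        then show ?thesis using rem cond False IH1 rp by auto
      qed
    next
      \<comment> \<open>Here \<open>y\<close> belongs to no full pair: if it is even, its partner
        could only be \<open>x\<close>, the largest entry below it, which is excluded; if it is odd,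
        its partner would exceed the largest entry. So dropping \<open>y\<close> changes no removed
        pair.\<close>
      case False
      define m where "m = nat (y div 2)"
      have y: "y = 2 * int m \<or> y = 2 * int m + 1" using ord unfolding m_def by auto
      have le: "\<forall>z\<in>?B. z \<le> y" using ord unfolding b by fastforce
      have nm: "\<not> (2 * int i + 2 = y \<and> 2 * int i + 1 \<in> ?B)" for i
      proof
        assume *: "2 * int i + 2 = y \<and> 2 * int i + 1 \<in> ?B"
        then have "2 * int i + 1 \<noteq> x" using False by auto
        with * have "2 * int i + 1 < x" using ord unfolding b by auto
        with * ord(3) show False by linarith
      qed
      have "i \<in> removed_pairs ?B \<longleftrightarrow> i \<in> removed_pairs (set (b0 @ [x]))" for i
      proof (cases "2 * int i + 2 < y")
        case True
        show ?thesis
          by (rule removed_pairs_cong[of "Suc i"]) (use True in \<open>auto simp: b\<close>)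
      next
        case False
        then show ?thesis using le nm[of i] ord unfolding b by (fastforce simp: removed_pairs_def)
      qed
      then have "removed_pairs ?B = removed_pairs (set (b0 @ [x]))" by blast
      moreover have "removal b = removal (b0 @ [x])" unfolding rem using False by argo
      ultimately show ?thesis using IH1 by metis
    qed
  qed
qed

section \<open>Injectivity of the reduction\<close>

lemma red_set:
  assumes "b \<in> SST N l"
  shows "set (red b) = set b - pairs (removed_pairs (set b))"
proof -
  have "removal b = pairs (removed_pairs (set b))"
    by (rule removal_eq) (use assms in \<open>auto simp: SST_def\<close>)
  then show ?thesis by (auto simp: red_def)
qed

text \<open>Only full pairs met at depth 0 disappear, so the kept set fixes how the depth moves,
  except at a pair without kept entries, which is either removed at depth 0 or empty.\<close>

lemma depth_step_kept:
  fixes B i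
  defines "C \<equiv> B - pairs (removed_pairs B)"
  shows "2 * int i + 1 \<in> C \<Longrightarrow> 2 * int i + 2 \<in> C \<Longrightarrow>
      0 < depth B i \<and> depth B (Suc i) = depth B i - 1"
    and "(2 * int i + 1 \<in> C) \<noteq> (2 * int i + 2 \<in> C) \<Longrightarrow> depth B (Suc i) = depth B i"
    and "2 * int i + 1 \<notin> C \<Longrightarrow> 2 * int i + 2 \<notin> C \<Longrightarrow>
      depth B i = 0 \<and> depth B (Suc i) = 0 \<and> 2 * int i + 1 \<in> B \<and> 2 * int i + 2 \<in> B
      \<or> depth B (Suc i) = Suc (depth B i) \<and> 2 * int i + 1 \<notin> B \<and> 2 * int i + 2 \<notin> B"
  by (auto simp: C_def removed_pairs_def)

text \<open>At a pair with a kept entry both depths move alike, no decrement being truncated. At a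
  pair without one, \<open>B'\<close> has positive depth and cannot remove it, so its depth rises by
  one, while that of \<open>B\<close> rises by at most one.\<close>

lemma depth_less_persists:
  assumes "B - pairs (removed_pairs B) = B' - pairs (removed_pairs B')"
    and "depth B i < depth B' i" "i \<le> j"
  shows "depth B j < depth B' j"
  using assms(3)
proof (induction j rule: dec_induct)
  case (step j)
  let ?C = "B - pairs (removed_pairs B)"
  have C': "?C = B' - pairs (removed_pairs B')" by fact
  consider "2 * int j + 1 \<in> ?C" "2 * int j + 2 \<in> ?C"
    | "(2 * int j + 1 \<in> ?C) \<noteq> (2 * int j + 2 \<in> ?C)"
    | "2 * int j + 1 \<notin> ?C" "2 * int j + 2 \<notin> ?C" by blast
  then show ?case
  proof cases
    case 1
    from depth_step_kept(1)[OF 1] depth_step_kept(1)[OF 1[unfolded C']] step.IH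
    show ?thesis by linarith
  next
    case 2
    from depth_step_kept(2)[OF 2] depth_step_kept(2)[OF 2[unfolded C']] step.IH
    show ?thesis by linarith
  next
    case 3
    from depth_step_kept(3)[OF 3] depth_step_kept(3)[OF 3[unfolded C']] step.IH
    show ?thesis by linarith
  qed
qed (fact assms(2))

text \<open>This is the counting invariant after \<open>N\<close> pairs, with two entries lost per
  removed pair. The first \<open>N\<close> pairs reach up to \<open>2 * N\<close> and so contain the
  whole column.\<close>

lemma depth_at_end:
  assumes "b \<in> SST N l"
  shows "2 * depth (set b) N + l = 2 * N - card (set (red b))" (is ?A)
    and "removed_pairs (set b) \<subseteq> {..<N}" (is ?B)
proof -
  from assms have b: "length b = l" "distinct b" "set b \<subseteq> {1..int N}"
    by (auto simp: SST_def strict_sorted_iff)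
  show ?B
  proof
    fix i assume "i \<in> removed_pairs (set b)"
    then have "2 * int i + 1 \<in> set b" by (simp add: removed_pairs_def)
    with b(3) show "i \<in> {..<N}" by fastforce
  qed
  have fin: "finite (removed_pairs (set b))" using \<open>?B\<close> by (rule finite_subset) simp
  have "card (set b) = card (set (red b)) + 2 * card (removed_pairs (set b))"
    unfolding red_set[OF assms] card_pairs[OF fin, symmetric]
    using pairs_removed_subset[of "set b"]
    by (simp add: card_Diff_subset finite_pairs fin card_mono)
  moreover have "set b \<inter> {1..2 * int N} = set b" using b(3) by fastforce
  moreover have "removed_pairs (set b) \<inter> {..<N} = removed_pairs (set b)" using \<open>?B\<close> by blast
  ultimately show ?A
    using card_add_depth[of "set b" N] b distinct_card[of b] by simp
qed

lemma red_inj: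
  assumes "b \<in> SST N l" "b' \<in> SST N l" "red b = red b'"
  shows "b = b'"
proof -
  let ?B = "set b" and ?B' = "set b'"
  have kept: "?B - pairs (removed_pairs ?B) = ?B' - pairs (removed_pairs ?B')"
    using assms red_set by metis
  have last: "depth ?B N = depth ?B' N"
    using depth_at_end(1)[OF assms(1)] depth_at_end(1)[OF assms(2)] assms(3) by simp
  \<comment> \<open>A strict inequality at \<open>i\<close>, in either direction, would persist up
    to \<open>N\<close>.\<close>
  have d: "depth ?B i = depth ?B' i" if "i \<le> N" for i
    using depth_less_persists[OF kept _ that] depth_less_persists[OF kept[symmetric] _ that] last
    by (metis less_irrefl linorder_neqE_nat)
  have "i \<in> removed_pairs ?B \<longleftrightarrow> i \<in> removed_pairs ?B'" if "i < N" for i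
  \<comment> \<open>A pair with a kept entry is removed in neither column. At a pair without one,
    removal keeps the depth and emptiness raises it, so equal depths before and after force the same
    choice.\<close>
  proof (cases "2 * int i + 1 \<in> ?B - pairs (removed_pairs ?B) \<or>
      2 * int i + 2 \<in> ?B - pairs (removed_pairs ?B)")
    case True
    then show ?thesis using kept by (metis DiffD2 odd_mem_pairs even_mem_pairs)
  next
    case False
    then have n: "2 * int i + 1 \<notin> ?B - pairs (removed_pairs ?B)"
      "2 * int i + 2 \<notin> ?B - pairs (removed_pairs ?B)" by auto
    show ?thesis
      using depth_step_kept(3)[OF n] depth_step_kept(3)[OF n[unfolded kept]]
        d[of i] d[of "Suc i"] that by (auto simp: removed_pairs_def)
  qed
  then have "removed_pairs ?B = removed_pairs ?B'"
    using depth_at_end(2)[OF assms(1)] depth_at_end(2)[OF assms(2)] by blast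
  then have "?B = ?B'" using kept pairs_removed_subset by (metis Un_Diff_cancel2 sup.absorb1)
  then show ?thesis using assms strict_sorted_equal by (auto simp: SST_def)
qed

section \<open>Columns made of full pairs\<close>

lemma depth_pairs_Suc:
  "depth (pairs P) (Suc i) = (if i \<in> P then depth (pairs P) i - 1 else Suc (depth (pairs P) i))"
  by simp

lemma depth_pairs_full_run:
  assumes "{i..<i + m} \<subseteq> P"
  shows "depth (pairs P) (i + m) = depth (pairs P) i - m"
  using assms by (induction m) (auto simp: subset_iff depth_pairs_Suc simp del: depth.simps(2))

lemma depth_pairs_empty_run:
  assumes "{i..<i + m} \<inter> P = {}"
  shows "depth (pairs P) (i + m) = depth (pairs P) i + m"
  using assms by (induction m) (auto simp: disjoint_iff depth_pairs_Suc simp del: depth.simps(2))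

text \<open>All quantities are halved so as to count pairs: block \<open>j\<close> starts at pair
  \<open>p j\<close> and has \<open>\<tau> j\<close> pairs, \<open>\<rho> j\<close> and
  \<open>\<sigma> j\<close> stand for r_j / 2 and G_j / 2, and \<open>\<sigma> (Suc k)\<close> for
  (l - t) / 2. Index 0 is a fictitious empty block at the origin, which makes the initial interval
  the gap after a block. \<open>p_eq\<close> is the definition of r_j solved for the block
  start.\<close>

locale staircase =
  fixes k :: nat and p \<tau> \<rho> \<sigma> :: "nat \<Rightarrow> nat"
  assumes start: "p 0 = 0" "\<tau> 0 = 0" "\<sigma> 0 = 0"
    and p_eq: "j \<le> k \<Longrightarrow> p j = \<rho> j + 2 * (\<Sum>m<j. \<tau> m) + \<tau> j"
    and \<sigma>_le: "j \<le> k \<Longrightarrow> \<sigma> j \<le> \<rho> j"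
    and \<sigma>_mono: "j \<le> k \<Longrightarrow> \<sigma> j \<le> \<sigma> (Suc j)"
    and \<sigma>_strict: "j \<le> k \<Longrightarrow> \<sigma> j < \<sigma> (Suc j) \<Longrightarrow> \<sigma> j = \<rho> j"
    and apart: "j < k \<Longrightarrow> p j + \<tau> j \<le> p (Suc j)"
begin

text \<open>A block and the gap after it form one run of full pairs, from \<open>p j\<close> up to
  but excluding \<open>e j\<close>.\<close>

definition e where "e j = p j + \<tau> j + (\<sigma> (Suc j) - \<sigma> j)"

abbreviation P where "P \<equiv> (\<Union>j\<le>k. {p j..<e j})"

lemma p_le_e: "p j \<le> e j"
  by (simp add: e_def)

text \<open>A nonempty gap forces \<open>\<sigma> j = \<rho> j\<close>. Then \<open>e j\<close> is
  twice the sum of the \<open>\<tau> m\<close> with \<open>m \<le> j\<close>, plus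
  \<open>\<sigma> (Suc j)\<close>, and \<open>\<sigma>_le\<close> at \<open>Suc j\<close> bounds
  this. Otherwise the block spacing suffices.\<close>

lemma e_le: assumes "j < k" shows "e j \<le> p (Suc j)"
proof (cases "\<sigma> j < \<sigma> (Suc j)")
  case True
  then show ?thesis
    using assms \<sigma>_strict[of j] \<sigma>_le[of "Suc j"] p_eq[of j] p_eq[of "Suc j"]
    by (simp add: e_def)
next
  case False
  then show ?thesis using apart[OF assms] by (simp add: e_def)
qed

lemma p_mono: "i \<le> j \<Longrightarrow> j \<le> k \<Longrightarrow> p i \<le> p j"
proof (induction j rule: dec_induct)
  case (step j)
  then show ?case using e_le[of j] by (simp add: e_def)
qed simp

lemma e_le_p: "i < j \<Longrightarrow> j \<le> k \<Longrightarrow> e i \<le> p j"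
  using e_le[of i] p_mono[of "Suc i" j] by simp

lemma gap_empty: assumes "j < k" shows "{e j..<p (Suc j)} \<inter> P = {}"
proof -
  have "{e j..<p (Suc j)} \<inter> {p i..<e i} = {}" if "i \<le> k" for i
  proof (cases "i \<le> j")
    case True
    then have "e i \<le> e j" using e_le_p[of i j] assms by (cases "i = j") (auto simp: e_def)
    then show ?thesis by auto
  next
    case False
    then have "p (Suc j) \<le> p i" using p_mono[of "Suc j" i] that by simp
    then show ?thesis by auto
  qed
  then show ?thesis by blast
qed

lemma depth_in:
  assumes "j \<le> k" "s \<le> e j - p j"
  shows "depth (pairs P) (p j + s) = depth (pairs P) (p j) - s"
  by (rule depth_pairs_full_run) (use assms in \<open>auto intro!: bexI[of _ j]\<close>)

text \<open>Across run \<open>j\<close> the depth falls by one per pair, then rises through the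
  empty pairs up to the next block. If the gap is empty, nothing is truncated; if not, the depth
  starts at \<open>\<tau> j\<close>, reaches 0 at the end of the block and stays there through the
  gap.\<close>

lemma depth_p: "j \<le> k \<Longrightarrow> depth (pairs P) (p j) = \<rho> j + \<tau> j - \<sigma> j"
proof (induction j)
  case 0
  then show ?case using start p_eq[of 0] by simp
next
  case (Suc j)
  have de: "depth (pairs P) (e j) = \<rho> j + \<tau> j - \<sigma> j - (e j - p j)"
    using depth_in[of j "e j - p j"] Suc by (simp add: le_add_diff_inverse p_le_e)
  have "depth (pairs P) (e j + (p (Suc j) - e j)) = depth (pairs P) (e j) + (p (Suc j) - e j)"
    by (rule depth_pairs_empty_run) (use gap_empty[of j] e_le[of j] Suc.prems in simp)
  then have "depth (pairs P) (p (Suc j)) = \<rho> j + \<tau> j - \<sigma> j - (e j - p j) + (p (Suc j) - e j)"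
    using de e_le[of j] Suc.prems by simp
  then show ?case
    using Suc.prems e_le[of j] \<sigma>_le[of j] \<sigma>_mono[of j] \<sigma>_strict[of j] \<sigma>_le[of "Suc j"]
      p_eq[of j] p_eq[of "Suc j"]
    by (cases "\<sigma> j < \<sigma> (Suc j)") (auto simp: e_def)
qed

lemma removed_pairs_staircase:
  "removed_pairs (pairs P) = (\<Union>j\<le>k. {p j + \<tau> j..<e j})"
proof -
  \<comment> \<open>If \<open>\<sigma> j < \<rho> j\<close>, the gap is empty and the depth stays
    positive on the run; if they are equal, the depth reaches 0 exactly at the end of the
    block.\<close>
  have zero: "depth (pairs P) i = 0 \<longleftrightarrow> p j + \<tau> j \<le> i" if "j \<le> k" "i \<in> {p j..<e j}" for i j
  proof -
    have "depth (pairs P) i = \<rho> j + \<tau> j - \<sigma> j - (i - p j)"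
      using depth_in[of j "i - p j"] depth_p[of j] that by (simp add: diff_le_mono)
    then show ?thesis
      using that \<sigma>_le[of j] \<sigma>_strict[of j] by (auto simp: e_def)
  qed
  show ?thesis
  proof (intro equalityI subsetI)
    fix i assume "i \<in> removed_pairs (pairs P)"
    then have "i \<in> P" "depth (pairs P) i = 0" by (simp_all add: removed_pairs_def del: UN_iff)
    then obtain j where "j \<le> k" "i \<in> {p j..<e j}" by blast
    with zero[OF this] \<open>depth (pairs P) i = 0\<close> show "i \<in> (\<Union>j\<le>k. {p j + \<tau> j..<e j})" by auto
  next
    fix i assume "i \<in> (\<Union>j\<le>k. {p j + \<tau> j..<e j})"
    then obtain j where j: "j \<le> k" "i \<in> {p j + \<tau> j..<e j}" by blast
    then have i: "i \<in> {p j..<e j}" by simp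
    with j have "i \<in> P" by blast
    moreover have "depth (pairs P) i = 0" using zero[OF j(1) i] j(2) by simp
    ultimately show "i \<in> removed_pairs (pairs P)" by (simp add: removed_pairs_def del: UN_iff)
  qed
qed

lemma kept_staircase:
  "pairs P - pairs (removed_pairs (pairs P)) = (\<Union>j\<le>k. pairs {p j..<p j + \<tau> j})"
proof -
  have apart: "{p j..<p j + \<tau> j} \<inter> {p j' + \<tau> j'..<e j'} = {}" if "j \<le> k" "j' \<le> k" for j j'
    using that e_le_p[of j j'] e_le_p[of j' j]
    by (cases j j' rule: linorder_cases) (auto simp: e_def)
  have split: "{p j..<e j} = {p j..<p j + \<tau> j} \<union> {p j + \<tau> j..<e j}" for j
    by (auto simp: e_def)
  have "P - (\<Union>j\<le>k. {p j + \<tau> j..<e j}) = (\<Union>j\<le>k. {p j..<p j + \<tau> j})"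
  proof (intro equalityI subsetI)
    fix i assume "i \<in> P - (\<Union>j\<le>k. {p j + \<tau> j..<e j})"
    then show "i \<in> (\<Union>j\<le>k. {p j..<p j + \<tau> j})" using split by blast
  next
    fix i assume "i \<in> (\<Union>j\<le>k. {p j..<p j + \<tau> j})"
    then obtain j where j: "j \<le> k" "i \<in> {p j..<p j + \<tau> j}" by blast
    then have "i \<in> P" using split by blast
    moreover have "i \<notin> (\<Union>j\<le>k. {p j + \<tau> j..<e j})" using apart[OF j(1)] j(2) by blast
    ultimately show "i \<in> P - (\<Union>j\<le>k. {p j + \<tau> j..<e j})" by blast
  qed
  then show ?thesis
    by (simp only: removed_pairs_staircase pairs_Diff[symmetric] pairs_UN[symmetric])
qed

text \<open>The parameter serves inductions on the number of runs; the column of interest is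
  \<open>column k\<close>.\<close>

definition column where
  "column i = concat (map (\<lambda>j. [2 * int (p j) + 1..2 * int (e j)]) [0..<Suc i])"

lemma column_0: "column 0 = [2 * int (p 0) + 1..2 * int (e 0)]"
  by (simp add: column_def)

lemma column_Suc: "column (Suc i) = column i @ [2 * int (p (Suc i)) + 1..2 * int (e (Suc i))]"
  by (simp add: column_def)

lemma set_column: "set (column k) = pairs P"
proof -
  have "set [0..<Suc k] = {..k}" by auto
  then have "set (column k) = (\<Union>j\<le>k. {2 * int (p j) + 1..2 * int (e j)})"
    unfolding column_def set_concat set_map by simp
  then show ?thesis by (simp only: pairs_UN pairs_interval)
qed

lemma sorted_column:
  "i \<le> k \<Longrightarrow> sorted_wrt (<) (column i) \<and> (\<forall>x\<in>set (column i). x \<le> 2 * int (e i))"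
proof (induction i)
  case 0 then show ?case by (simp add: column_0)
next
  case (Suc i)
  have "e i \<le> p (Suc i)" "p (Suc i) \<le> e (Suc i)"
    using e_le[of i] p_le_e[of "Suc i"] Suc.prems by auto
  moreover from Suc have "sorted_wrt (<) (column i)" "\<And>x. x \<in> set (column i) \<Longrightarrow> x \<le> 2 * int (e i)"
    by auto
  ultimately show ?case unfolding column_Suc sorted_wrt_append by force
qed

text \<open>The gap lengths are differences of consecutive values of \<sigma> and telescope.\<close>

lemma length_column: "i \<le> k \<Longrightarrow> length (column i) = 2 * (\<Sum>m\<le>i. \<tau> m) + 2 * \<sigma> (Suc i)"
proof (induction i)
  case 0 then show ?case using start by (simp add: column_0 e_def)
next
  case (Suc i)
  have "length [2 * int (p (Suc i)) + 1..2 * int (e (Suc i))] = 2 * (e (Suc i) - p (Suc i))"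
    by simp
  also have "\<dots> + 2 * \<sigma> (Suc i) = 2 * \<tau> (Suc i) + 2 * \<sigma> (Suc (Suc i))"
    using \<sigma>_mono[OF Suc.prems] by (simp add: e_def)
  finally show ?case using Suc by (simp add: column_Suc)
qed

text \<open>The first assumption bounds the end \<open>e k\<close> when the last gap is empty. When
  it is not, \<open>\<sigma> k = \<rho> k\<close> turns \<open>e k\<close> into the left side of the
  second.\<close>

lemma column_bound:
  assumes "p k + \<tau> k \<le> n" "2 * (\<Sum>m\<le>k. \<tau> m) + \<sigma> (Suc k) \<le> n"
  shows "set (column k) \<subseteq> {1..2 * int n}"
proof -
  have "e k \<le> n"
    using assms \<sigma>_strict[of k] \<sigma>_le[of k] p_eq[of k]
    by (cases "\<sigma> k < \<sigma> (Suc k)") (auto simp: e_def lessThan_Suc_atMost[symmetric])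
  then have "e j \<le> n" if "j \<le> k" for j
    using e_le_p[of j k] p_le_e[of k] that by (cases "j = k") auto
  then have "P \<subseteq> {0..<n}" by fastforce
  then have "pairs P \<subseteq> pairs {0..<n}" by (auto simp only: pairs_def)
  then show ?thesis by (simp only: set_column pairs_interval) simp
qed

end

section \<open>Partial sums of the gap lengths and the symplectic bound\<close>

lemma gap_partial_sums:
  fixes a t k l
  defines "G \<equiv> \<lambda>i. \<Sum>m = 1..i. gap a t k l m"
    and "r \<equiv> \<lambda>j. a j - 2 * (\<Sum>m = 1..<j. int (t m)) - int (t j) - 1"
    and "L \<equiv> int l - (\<Sum>m = 1..k. int (t m))"
  assumes "1 \<le> i"
  shows "G i = Min (insert L (r ` {i..k}))"
proof -
  obtain i' where i: "i = Suc i'" using assms by (cases i) auto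
  let ?s = "\<Sum>m = 1..i'. gap a t k l m"
  \<comment> \<open>Every candidate in the recursion subtracts the same earlier sum
    \<open>?s\<close>, which therefore comes out of the minimum and cancels in
    \<open>G i\<close>.\<close>
  have "gap a t k l i = Min ((\<lambda>x. x - ?s) ` insert L (r ` {i..k}))"
    unfolding i by (subst gap.simps, rule arg_cong[of _ _ Min])
      (auto simp: r_def L_def atLeastLessThanSuc_atLeastAtMost simp del: sum.op_ivl_Suc)
  also have "\<dots> = Min (insert L (r ` {i..k})) - ?s"
    using Min_add_commute[of "insert L (r ` {i..k})" "\<lambda>x. x" "- ?s"] by (simp del: Min_insert)
  finally show ?thesis by (simp add: G_def i)
qed

lemma int_interval_append:
  fixes i j k :: int
  assumes "i \<le> j + 1" "j \<le> k"
  shows "[i..j] @ [j + 1..k] = [i..k]"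
proof (cases "i \<le> j")
  case True
  then show ?thesis using upto_split2[of i j k] assms by simp
next
  case False
  then have "i = j + 1" using assms by linarith
  then show ?thesis by simp
qed

text \<open>The symplectic condition is sharpest at the last entry of a block, which for block
  \<open>i\<close> sits at position \<open>q\<close>, the total length of the first \<open>i\<close>
  blocks.\<close>

lemma symplectic_block_bound:
  assumes c: "concat (map (block a t) [1..<Suc k]) \<in> SpT N (\<Sum>m = 1..k. t m)"
    and i: "1 \<le> i" "i \<le> k" "t i > 0"
  shows "2 * (\<Sum>m = 1..i. int (t m)) \<le> a i + int (t i)"
proof -
  have len: "length (concat (map (block a t) [1..<Suc i])) = (\<Sum>m = 1..i. t m)" for i
    by (induction i) (auto simp: block_def)
  define q where "q = (\<Sum>m = 1..i. t m)"
  have "[1..<Suc k] = [1..<i] @ i # [Suc i..<Suc k]"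
    using i upt_add_eq_append[of 1 i "Suc k - i"] by (simp add: upt_conv_Cons)
  then have split: "concat (map (block a t) [1..<Suc k]) =
      concat (map (block a t) [1..<i]) @ block a t i @ concat (map (block a t) [Suc i..<Suc k])"
    by simp
  obtain i' where i': "i = Suc i'" using i by (cases i) auto
  have l: "length (concat (map (block a t) [1..<i])) + t i = q"
    using len[of i'] by (simp add: q_def i')
  have "concat (map (block a t) [1..<Suc k]) ! (q - 1) = block a t i ! (t i - 1)"
    unfolding split nth_append using l i by (auto simp: block_def)
  also have "\<dots> = a i + int (t i) - 1" using i by (simp add: block_def of_nat_diff)
  finally have "concat (map (block a t) [1..<Suc k]) ! (q - 1) = a i + int (t i) - 1" .
  moreover have "q \<in> {1..\<Sum>m = 1..k. t m}"
    using l i unfolding q_def by (auto intro!: sum_mono2)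
  ultimately have "2 * int q - 1 \<le> a i + int (t i) - 1"
    using c unfolding SpT_def by fastforce
  then show ?thesis by (simp add: q_def)
qed

section \<open>Construction and uniqueness of the preimage\<close>

theorem theorem6:
  fixes n k l :: nat and t :: "nat \<Rightarrow> nat" and a :: "nat \<Rightarrow> int" and c :: "int list"
  assumes "n \<ge> 1" and "k \<ge> 1" and "l \<le> 2 * n"
    and "\<forall>i\<in>{1..k}. t i > 0 \<and> even (t i)"
    and "(\<Sum>i = 1..k. t i) \<in> {1..n}"
    and "2 \<le> (\<Sum>i = 1..k. t i)"
    and "(\<Sum>i = 1..k. t i) \<le> min l (2 * n - l)"
    and "even (int l - int (\<Sum>i = 1..k. t i))"
    and "is_block_sum c k a t"
    and "c \<in> SpT (2 * n) (\<Sum>i = 1..k. t i)"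
  shows "(\<forall>i\<in>{1..k}. a i \<ge> 2 * (\<Sum>m = 1..<i. int (t m)) + int (t i) + 1) \<and>
    (\<forall>i\<in>{1..k}. gap a t k l i \<ge> 0 \<and> even (gap a t k l i)) \<and>
    last_gap a t k l \<ge> 0 \<and> even (last_gap a t k l) \<and>
    filled a t k l \<in> SST (2 * n) l \<and>
    red (filled a t k l) = c \<and>
    (\<forall>T \<in> SST (2 * n) l. red T = c \<longrightarrow> T = filled a t k l)"
proof -
  from assms(9) have c: "c = concat (map (block a t) [1..<Suc k])"
    and odd_a: "\<And>i. 1 \<le> i \<Longrightarrow> i \<le> k \<Longrightarrow> odd (a i)"
    and t_ge: "\<And>i. 1 \<le> i \<Longrightarrow> i \<le> k \<Longrightarrow> 2 \<le> t i"
    and even_t: "\<And>i. 1 \<le> i \<Longrightarrow> i \<le> k \<Longrightarrow> even (t i)"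
    and dist_a: "\<And>i. 1 \<le> i \<Longrightarrow> i < k \<Longrightarrow> a i + int (t i) + 2 \<le> a (Suc i)"
    unfolding is_block_sum_def by (auto simp: algebra_simps)
  have set_c: "set c = (\<Union>i\<in>{1..k}. {a i..a i + int (t i) - 1})"
  proof -
    have "set [1..<Suc k] = {1..k}" by auto
    then show ?thesis unfolding c set_concat set_map by (simp add: block_def)
  qed
  define G where "G i = (\<Sum>m = 1..i. gap a t k l m)" for i
  define r where "r j = a j - 2 * (\<Sum>m = 1..<j. int (t m)) - int (t j) - 1" for j
  define L where "L = int l - (\<Sum>m = 1..k. int (t m))"
  have G_0: "G 0 = 0" and G_Suc: "G (Suc i) = G i + gap a t k l (Suc i)" for i
    by (simp_all add: G_def)
  have last_gap: "last_gap a t k l = L - G k"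
    by (simp add: last_gap_def L_def G_def)
  have a_ge: "a i \<ge> 2 * (\<Sum>m = 1..<i. int (t m)) + int (t i) + 1" if i: "1 \<le> i" "i \<le> k" for i
  proof -
    have "{1..i} = insert i {1..<i}" using i by auto
    then have "(\<Sum>m = 1..i. int (t m)) = int (t i) + (\<Sum>m = 1..<i. int (t m))" by simp
    then have "2 * (\<Sum>m = 1..<i. int (t m)) + int (t i) \<le> a i"
      using symplectic_block_bound[OF assms(10)[unfolded c] i] t_ge[OF i] by simp
    \<comment> \<open>Parity improves the bound by one: \<open>a i\<close> is odd and the bound is
      even.\<close>
    moreover have "even (2 * (\<Sum>m = 1..<i. int (t m)) + int (t i))"
      using even_t[OF i] by simp
    then have "2 * (\<Sum>m = 1..<i. int (t m)) + int (t i) \<noteq> a i"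
      using odd_a[OF i] by metis
    ultimately show ?thesis by linarith
  qed
  have r: "0 \<le> r j \<and> even (r j)" if "1 \<le> j" "j \<le> k" for j
    using a_ge[OF that] odd_a[OF that] even_t[OF that] by (simp add: r_def)
  have L: "0 \<le> L" "even L"
    using assms(7,8) by (auto simp: L_def simp flip: of_nat_sum)
  have G_Min: "G i = Min (insert L (r ` {i..k}))" if "1 \<le> i" for i
    unfolding G_def r_def L_def using gap_partial_sums[OF that] by simp
  have G_le_r: "G i \<le> r j" if "1 \<le> i" "i \<le> j" "j \<le> k" for i j
    unfolding G_Min[OF that(1)] by (rule Min_le) (use that in auto)
  have G_le_L: "G i \<le> L" if "i \<le> k" for i
    using L G_Min[of i] by (cases "i = 0") (simp_all add: G_0)
  have G_in: "G i = L \<or> (\<exists>j. i \<le> j \<and> j \<le> k \<and> G i = r j)" if "1 \<le> i" for i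
  proof -
    have "G i \<in> insert L (r ` {i..k})" unfolding G_Min[OF that] by (rule Min_in) auto
    then show ?thesis by auto
  qed
  have G: "0 \<le> G i \<and> even (G i)" if "i \<le> k" for i
    using G_in[of i] L r by (cases "i = 0") (auto simp: G_0)
  have G_mono: "G i \<le> G (Suc i)" if "i < k" for i
    \<comment> \<open>\<open>G (Suc i)\<close> is \<open>L\<close> or some \<open>r j\<close> with
      \<open>j > i\<close>, and each of these bounds \<open>G i\<close>; for \<open>i = 0\<close>
      this is nonnegativity.\<close>
    using G_in[of "Suc i"] G_le_L[of i] G_le_r[of i] G[of "Suc i"] that
    by (cases "i = 0") (auto simp: G_0)
  have G_strict: "G i = r i" if i: "1 \<le> i" "i < k" "G i < G (Suc i)" for i
  proof -
    \<comment> \<open>\<open>G i\<close> lies below \<open>G (Suc i) \<le> L\<close>, so it is some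
      \<open>r j\<close>. With \<open>j > i\<close>, the same \<open>r j\<close> would also bound
      \<open>G (Suc i)\<close>.\<close>
    obtain j where j: "i \<le> j" "j \<le> k" "G i = r j"
      using G_in[of i] G_le_L[of "Suc i"] i by auto
    then have "j = i" using G_le_r[of "Suc i" j] i by (cases "j = i") auto
    then show ?thesis using j by simp
  qed
  have G_last: "G k = r k" if "G k < L"
    using G_in[of k] that assms(2) by auto

  \<comment> \<open>The values at 0 encode the fictitious empty block, and \<sigma> continues past
    \<open>k\<close> with half of \<open>L\<close>, so that the last gap is a difference of \<sigma>
    like the others.\<close>
  define \<tau> where "\<tau> j = (if j = 0 then 0 else t j div 2)" for j
  define p where "p j = (if j = 0 then 0 else nat (a j div 2))" for j
  define \<rho> where "\<rho> j = (if j = 0 then 0 else nat (r j div 2))" for j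
  define \<sigma> where "\<sigma> j = (if j \<le> k then nat (G j div 2) else nat (L div 2))" for j
  have t2: "t j = 2 * \<tau> j" if "1 \<le> j" "j \<le> k" for j
    using that even_t[OF that] by (simp add: \<tau>_def)
  have a2: "a j = 2 * int (p j) + 1" if "1 \<le> j" "j \<le> k" for j
  proof -
    have "0 \<le> (\<Sum>m = 1..<j. int (t m))" by (rule sum_nonneg) simp
    then have "0 \<le> a j" using a_ge[OF that] by linarith
    then show ?thesis using that odd_a[OF that] by (simp add: p_def)
  qed
  have r2: "r j = 2 * int (\<rho> j)" if "1 \<le> j" "j \<le> k" for j
    using that r[OF that] by (simp add: \<rho>_def)
  have G2: "G j = 2 * int (\<sigma> j)" if "j \<le> k" for j
    using that G[OF that] by (simp add: \<sigma>_def)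
  have L2: "L = 2 * int (\<sigma> (Suc k))"
    using L by (simp add: \<sigma>_def)
  have sum_t: "(\<Sum>m = 1..<j. int (t m)) = 2 * int (\<Sum>m<j. \<tau> m)" if "j \<le> Suc k" for j
  proof -
    have "(\<Sum>m<j. \<tau> m) = (\<Sum>m = 1..<j. \<tau> m)"
      by (rule sum.mono_neutral_right) (auto simp: \<tau>_def)
    moreover have "(\<Sum>m = 1..<j. int (t m)) = (\<Sum>m = 1..<j. 2 * int (\<tau> m))"
      by (rule sum.cong) (use that t2 in auto)
    ultimately show ?thesis by (simp add: sum_distrib_left)
  qed
  have L_eq: "int l = 2 * int (\<Sum>m\<le>k. \<tau> m) + L"
    using sum_t[of "Suc k"]
    by (simp add: L_def atLeastLessThanSuc_atLeastAtMost lessThan_Suc_atMost)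
  have l_eq: "l = 2 * (\<Sum>m\<le>k. \<tau> m) + 2 * \<sigma> (Suc k)"
    using L_eq L2 by linarith

  interpret staircase k p \<tau> \<rho> \<sigma>
  proof
    show "p 0 = 0" "\<tau> 0 = 0" "\<sigma> 0 = 0" by (simp_all add: p_def \<tau>_def \<sigma>_def G_0)
  next
    fix j assume j: "j \<le> k"
    show "p j = \<rho> j + 2 * (\<Sum>m<j. \<tau> m) + \<tau> j"
    proof (cases "j = 0")
      case False
      then have "int (t j) = 2 * int (\<tau> j)" using j t2[of j] by simp
      then have "int (p j) = int (\<rho> j) + 2 * int (\<Sum>m<j. \<tau> m) + int (\<tau> j)"
        using False j a2[of j] r2[of j] sum_t[of j] unfolding r_def by linarith
      then show ?thesis by linarith
    qed (simp add: p_def \<tau>_def \<rho>_def)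
    show "\<sigma> j \<le> \<rho> j"
    proof (cases "j = 0")
      case False
      then show ?thesis using j G2[of j] r2[of j] G_le_r[of j j] by simp
    qed (simp add: \<sigma>_def G_0)
    show "\<sigma> j \<le> \<sigma> (Suc j)"
      using j G2[of j] G2[of "Suc j"] L2 G_mono[of j] G_le_L[of k] by (cases "j = k") auto
    show "\<sigma> j = \<rho> j" if "\<sigma> j < \<sigma> (Suc j)"
    proof (cases "j = 0")
      case False
      then show ?thesis
        using that j G2[of j] G2[of "Suc j"] L2 r2[of j] G_strict[of j] G_last
        by (cases "j = k") auto
    qed (simp add: \<sigma>_def \<rho>_def G_0)
  next
    fix j assume "j < k"
    show "p j + \<tau> j \<le> p (Suc j)"
    proof (cases "j = 0")
      case False
      then show ?thesis
        using \<open>j < k\<close> a2[of j] a2[of "Suc j"] t2[of j] dist_a[of j] by simp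
    qed (simp add: p_def \<tau>_def)
  qed

  \<comment> \<open>A single formula for all gaps, the first one at \<open>i = 0\<close> and the
    last at \<open>i = k\<close>. It yields nonnegativity and evenness at once.\<close>
  have next_gap: "(if i < k then gap a t k l (Suc i) else last_gap a t k l) =
      2 * int (\<sigma> (Suc i) - \<sigma> i)" if "i \<le> k" for i
    using that G_Suc[of i] G2[of i] G2[of "Suc i"] L2 last_gap \<sigma>_mono[of i]
    by (cases "i = k") (auto simp: of_nat_diff)
  have filled: "filled a t k l = column k"
  proof -
    have first: "[1..gap a t k l 1] = [2 * int (p 0) + 1..2 * int (e 0)]"
      using next_gap[of 0] assms(2) by (simp add: e_def start)
    have segment: "block a t i @ [a i + int (t i)..a i + int (t i) - 1 +
           (if i < k then gap a t k l (Suc i) else last_gap a t k l)]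
        = [2 * int (p i) + 1..2 * int (e i)]" if "1 \<le> i" "i \<le> k" for i
      using int_interval_append[of "2 * int (p i) + 1" "2 * int (p i + \<tau> i)" "2 * int (e i)"]
      unfolding next_gap[OF that(2)] block_def a2[OF that] t2[OF that]
      by (simp add: e_def algebra_simps)
    have "map (\<lambda>i. block a t i @ [a i + int (t i)..a i + int (t i) - 1 +
           (if i < k then gap a t k l (Suc i) else last_gap a t k l)]) [1..<Suc k] =
        map (\<lambda>i. [2 * int (p i) + 1..2 * int (e i)]) [1..<Suc k]"
      by (rule map_cong[OF refl], rule segment) auto
    moreover have "[0..<Suc k] = 0 # [1..<Suc k]" by (simp add: upt_conv_Cons)
    ultimately show ?thesis
      by (simp only: filled_def column_def first list.map concat.simps)
  qed
  have c_SST: "c \<in> SST (2 * n) (\<Sum>i = 1..k. t i)" using assms(10) by (simp add: SpT_def)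
  have SST: "column k \<in> SST (2 * n) l"
  proof -
    \<comment> \<open>The last entry of the last block belongs to \<open>c\<close>, hence is at most
      \<open>2 * n\<close>.\<close>
    have "a k + int (t k) - 1 \<in> set c"
      unfolding set_c using assms(2) t_ge[of k] by (intro UN_I[of k]) auto
    then have "a k + int (t k) - 1 \<le> 2 * int n" using c_SST by (auto simp: SST_def)
    then have "p k + \<tau> k \<le> n" using a2[of k] t2[of k] assms(2) by simp
    \<comment> \<open>This is half of t + l \<le> 2n, since l is t plus \<open>L\<close>.\<close>
    moreover have "2 * (\<Sum>m\<le>k. \<tau> m) + \<sigma> (Suc k) \<le> n"
      using L_eq L2 sum_t[of "Suc k"] assms(3,7)
      by (simp add: atLeastLessThanSuc_atLeastAtMost lessThan_Suc_atMost flip: of_nat_sum)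
    ultimately have "set (column k) \<subseteq> {1..2 * int n}" by (rule column_bound)
    then show ?thesis
      using sorted_column[of k] length_column[of k] l_eq by (simp add: SST_def)
  qed
  have "set (red (column k)) = set c"
  proof -
    have "pairs {p j..<p j + \<tau> j} = {a j..a j + int (t j) - 1}" if "1 \<le> j" "j \<le> k" for j
      unfolding pairs_interval a2[OF that] t2[OF that] by auto
    moreover have "pairs {p 0..<p 0 + \<tau> 0} = {}" using start by (simp add: pairs_def)
    moreover have "{..k} = insert 0 {1..k}" by auto
    ultimately show ?thesis
      unfolding red_set[OF SST] set_column kept_staircase set_c by simp
  qed
  moreover have "sorted_wrt (<) (red (column k))"
    using sorted_column[of k] by (simp add: red_def sorted_wrt_filter)
  moreover have "sorted_wrt (<) c" using c_SST by (simp add: SST_def)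
  ultimately have red: "red (column k) = c" by (metis strict_sorted_equal)
  have gaps: "gap a t k l i \<ge> 0 \<and> even (gap a t k l i)" if i: "i \<in> {1..k}" for i
    using next_gap[of "i - 1"] i by (cases i) auto
  have "last_gap a t k l \<ge> 0 \<and> even (last_gap a t k l)"
    using next_gap[of k] by simp
  with a_ge gaps SST red red_inj[OF _ SST] show ?thesis
    unfolding filled by (metis atLeastAtMost_iff)
qed

end
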